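(* Let $r\ge 1$ be an integer, let $p$ be a prime number, and let $k\ge 1$ and $n_k\ge r$ be integers such that $p^k\mid C_r(n_k)$. For integers $n\ge r$ put $$\hat q_p(n)=\frac1p\left((-1)^pC_r(n+p)-C_r(n)\right).$$ (1) If $v_p(\hat q_p(n_k))=0$, then there exists a unique $n_{k+1}$ modulo $p^{k+1}$ for which $n_{k+1}\equiv n_k\pmod{p^k}$ and $p^{k+1}\mid C_r(n)$ for all $n\ge r$ with $n\equiv n_{k+1}\pmod{p^{k+1}}$. Moreover, $n_{k+1}\equiv n_k-\frac{C_r(n_k)}{\hat q_p(n_k)}\pmod{p^{k+1}}$. (2) If $v_p(\hat q_p(n_k))>0$ and $p^{k+1}\mid C_r(n_k)$, then $p^{k+1}\mid C_r(n)$ for all $n\ge r$ such that $n\equiv n_k\pmod{p^k}$. (3) If $v_p(\hat q_p(n_k))>0$ and $p^{k+1}\nmid C_r(n_k)$, then $p^{k+1}\nmid C_r(n)$ for every $n\ge r$ such that $n\equiv n_k\pmod{p^k}$. In particular, if $k=1$, $p\mid C_r(n_1)$ and $v_p(\hat q_p(n_1))=0$, then for every integer $l\ge 1$ there exists a unique $n_l$ modulo $p^l$ such that $n_l\equiv n_1\pmod p$ and $v_p(C_r(n))\ge l$ for all $n\ge r$ with $n\equiv n_l\pmod{p^l}$. Moreover, choosing representatives $n_l\ge r$, one has for $l>1$ $$n_l\equiv n_{l-1}-\frac{C_r(n_{l-1})}{(-1)^{n_1+n_{l-1}}\hat q_p(n_1)}\pmod{p^l}.$$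
   Context: For integers $n,r\ge 0$, the $r$-derangement number $D_r(n)$ is the number of permutations of $\{1,\dots,n+r\}$ that have no fixed points and in whose cycle decomposition the elements $1,\dots,r$ lie in pairwise distinct cycles. For $r\ge 1$ and $n\ge r$ define $$C_r(n)=\frac{(n-r)!}{n!}D_r(n)=\sum_{j=r}^{n}\binom{j}{r}(n-r)_{j-r}(-1)^{n-j},$$ where $(x)_m=x(x-1)\cdots(x-m+1)$ for $m\ge 1$ and $(x)_0=1$; thus $C_r(n)$ is an integer. $v_p$ denotes the $p$-adic valuation on $\mathbb{Q}$, with $v_p(0)=+\infty$. It is a fact that $(-1)^pC_r(n+p)\equiv C_r(n)\pmod p$ for $n\ge r$, so $\hat q_p(n)$ is an integer. Division by an integer prime to $p$ in a congruence modulo $p^m$ means multiplication by its inverse modulo $p^m$. *)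

theory Defs
  imports
    "HOL-Number_Theory.Number_Theory"
    "HOL-Combinatorics.Orbits"
    "HOL-Library.Extended_Nat"
begin

text \<open>
  On permutations of a finite set, \<^term>\<open>orbit f i\<close> is the support of the cycle of \<^term>\<open>f\<close>
  containing \<^term>\<open>i\<close>, so injectivity on \<open>{1..r}\<close> says that \<open>1, \<dots>, r\<close> lie in pairwise
  distinct cycles.
\<close>
definition r_derangements :: "nat \<Rightarrow> nat \<Rightarrow> (nat \<Rightarrow> nat) set" where
  "r_derangements r n =
     {f. f permutes {1..n + r} \<and> (\<forall>i\<in>{1..n + r}. f i \<noteq> i) \<and> inj_on (orbit f) {1..r}}"

definition r_derangement_number :: "nat \<Rightarrow> nat \<Rightarrow> nat" where
  "r_derangement_number r n = card (r_derangements r n)"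

text \<open>
  Only used for \<open>n \<ge> r\<close>. There the division is exact: the quotient equals
  \<open>\<Sum>j=r..n. (j choose r) * (n-r)\<^bsub>j-r\<^esub> * (-1)^(n-j)\<close>, where \<open>(x)\<^bsub>m\<^esub>\<close> is the falling factorial.
\<close>
definition C_num :: "nat \<Rightarrow> nat \<Rightarrow> int" where
  "C_num r n = (fact (n - r) * int (r_derangement_number r n)) div fact n"

text \<open>
  The division is exact for prime \<open>p\<close> and \<open>n \<ge> r\<close>, since \<open>(-1)^p C_num r (n + p)\<close> and
  \<open>C_num r n\<close> are then congruent modulo \<open>p\<close>.
\<close>
definition q_hat :: "nat \<Rightarrow> nat \<Rightarrow> nat \<Rightarrow> int" where
  "q_hat r p n = ((-1) ^ p * C_num r (n + p) - C_num r n) div int p"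

text \<open>
  The \<open>p\<close>-adic valuation on the integers. It differs from \<^const>\<open>multiplicity\<close> at \<open>0\<close>, where
  \<^const>\<open>multiplicity\<close> returns \<open>0\<close>.
\<close>
definition padic_val :: "nat \<Rightarrow> int \<Rightarrow> enat" where
  "padic_val p x = (if x = 0 then \<infinity> else enat (multiplicity (int p) x))"

text \<open>
  \<open>a / b\<close> modulo \<open>m\<close>, meaningful for \<open>b\<close> coprime to \<open>m\<close>
  (\<^const>\<open>modular_inverse\<close> is \<open>0\<close> otherwise).
\<close>
definition mod_quot :: "int \<Rightarrow> int \<Rightarrow> int \<Rightarrow> int" where
  "mod_quot m a b = a * modular_inverse m b"

text \<open>There is exactly one residue class modulo \<open>m\<close> whose members satisfy \<open>P\<close>.\<close>
definition ex1_mod :: "int \<Rightarrow> (int \<Rightarrow> bool) \<Rightarrow> bool" where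
  "ex1_mod m P \<longleftrightarrow> (\<exists>x. \<forall>y. P y \<longleftrightarrow> [y = x] (mod m))"

end

theory Submission
  imports Defs
begin

text \<open>
  Permutations with \<open>1, \<dots>, r\<close> in distinct cycles are counted by inserting the other elements one at
  a time, into a cycle or as a fixed point; imposing \<open>f x \<noteq> x\<close> for one further \<open>x\<close> subtracts the count for the set without
  \<open>x\<close>. This yields \<open>(-1)\<^sup>m C\<^sub>r(r + m) = \<Sum>i. (-1)\<^sup>i (i + r choose r) (m)\<^sub>i\<close>, which for bounded \<open>m\<close> is an
  integer polynomial \<open>f\<close> in \<open>m\<close>. If \<open>p\<^sup>k\<close> divides \<open>h\<close> with \<open>k \<ge> 1\<close>, comparing the expansions
  of \<open>f(x + h)\<close> and \<open>f(x + p)\<close> to second order gives \<open>f(x + h) \<equiv> f(x) + h (f(x + p) - f(x)) / p\<close> modulo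
  \<open>p\<^bsup>k+1\<^esup>\<close>, and the quotient modulo \<open>p\<close> depends only on \<open>x\<close> modulo \<open>p\<close>. Up to signs it is the
  \<open>q\<close> of the statement, so all claims follow as in Hensel's lemma.
\<close>

subsection \<open>Counting derangements with separated elements\<close>

text \<open>\<open>U\<close> is kept apart from \<open>A\<close> so that fixed points can be
  forbidden one element at a time. The r-derangements are the case
  \<open>A = U = {1..n + r}\<close>, \<open>R = {1..r}\<close>.\<close>

definition separated_perms :: "'a set \<Rightarrow> 'a set \<Rightarrow> 'a set \<Rightarrow> ('a \<Rightarrow> 'a) set" where
  "separated_perms A R U = {f. f permutes A \<and> (\<forall>x\<in>U. f x \<noteq> x) \<and> inj_on (orbit f) R}"

lemma finite_separated_perms: "finite A \<Longrightarrow> finite (separated_perms A R U)"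
  unfolding separated_perms_def by (rule finite_subset[OF _ finite_permutations]) auto

section \<open>Cycles and the insertion of one element\<close>

lemma orbit_eq_iff:
  assumes "permutation f"
  shows "orbit f x = orbit f y \<longleftrightarrow> y \<in> orbit f x"
  using assms by (metis cyclic_on_orbit' orbit_cyclic_eq3 permutation_self_in_orbit)

lemma inj_on_orbit_iff:
  assumes "permutation f"
  shows "inj_on (orbit f) R \<longleftrightarrow> (\<forall>x\<in>R. \<forall>y\<in>R. y \<in> orbit f x \<longrightarrow> x = y)"
  by (auto simp: inj_on_def orbit_eq_iff[OF assms])

text \<open>For \<open>b\<close> in \<open>S\<close> the composition splices \<open>a\<close> into
  the cycle of \<open>b\<close>, directly before \<open>b\<close>; for \<open>b = a\<close> it
  leaves \<open>a\<close> fixed. Either way the old elements are shared out among cycles as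
  before.\<close>

lemma orbit_transpose_insert:
  assumes p: "p permutes S" and a: "a \<notin> S" and x: "x \<in> S" and y: "y \<in> S"
  shows "y \<in> orbit (transpose a b \<circ> p) x \<longleftrightarrow> y \<in> orbit p x"
proof -
  define q where "q = transpose a b \<circ> p"
  have pa: "p a = a" using p a by (simp add: permutes_not_in)
  have qa: "q a = b" by (simp add: q_def pa)
  have pS: "p z \<in> S \<longleftrightarrow> z \<in> S" for z using p by (simp add: permutes_in_image)
  have qb: "q z = a" if "p z = b" for z using that by (simp add: q_def)
  have qn: "q z = p z" if "p z \<noteq> b" "z \<in> S" for z
    using that pS[of z] a by (auto simp: q_def transpose_def)
  \<comment> \<open>A walk along \<open>p\<close> is imitated by \<open>q\<close>, with a detour
    through \<open>a\<close> whenever \<open>p\<close> arrives at \<open>b\<close>.\<close>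
  have 1: "z \<in> S \<and> z \<in> orbit q x" if "z \<in> orbit p x" for z using that
  proof induction
    case base
    show ?case using x pS qa qb[of x] qn[of x] by (metis orbit.base orbit.step)
  next
    case (step z)
    then show ?case using pS qa qb[of z] qn[of z] by (metis orbit.step)
  qed
  \<comment> \<open>A walk along \<open>q\<close> may stand at \<open>a\<close>, outside
    \<open>S\<close>; the invariant then speaks about its next stop \<open>b\<close>
    instead.\<close>
  have 2: "(z = a \<longrightarrow> b = a \<or> b \<in> orbit p x) \<and> (z \<noteq> a \<longrightarrow> z \<in> S \<and> z \<in> orbit p x)"
    if "z \<in> orbit q x" for z using that
  proof induction
    case base
    show ?case using x pS[of x] qb[of x] qn[of x] a by (metis orbit.base)
  next
    case (step z)
    show ?case
    proof (cases "z = a")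
      case True
      then have "b = a \<or> b \<in> orbit p x" using step by blast
      then show ?thesis using True qa 1 by auto
    next
      case False
      then show ?thesis using step qb[of z] qn[of z] pS[of z] a by (metis orbit.step)
    qed
  qed
  show ?thesis using 1 2 a y unfolding q_def by blast
qed

text \<open>\<open>permutes_insert\<close> parametrizes all permutations of the larger set, and as
  \<open>a\<close> is not in \<open>R\<close>, splicing respects separation. The last argument is
  \<open>{}\<close> because splicing can destroy fixed points.\<close>

lemma separated_perms_insert:
  assumes "finite A" "a \<notin> A" "R \<subseteq> A"
  shows "separated_perms (insert a A) R {} =
           (\<lambda>(b, p). transpose a b \<circ> p) ` (insert a A \<times> separated_perms A R {})"
proof -
  have *: "inj_on (orbit (transpose a b \<circ> p)) R \<longleftrightarrow> inj_on (orbit p) R"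
    if "b \<in> insert a A" "p permutes A" for b p
  proof -
    have "p permutes insert a A" using that permutes_subset by blast
    then have "transpose a b \<circ> p permutes insert a A"
      using that by (intro permutes_compose permutes_swap_id) auto
    then have "permutation (transpose a b \<circ> p)" "permutation p"
      using that assms(1) permutation_permutes by blast+
    then show ?thesis
      using orbit_transpose_insert[OF that(2) assms(2)] assms(3)
      by (auto simp: inj_on_orbit_iff subset_iff)
  qed
  have "separated_perms (insert a A) R {} =
          {f. f permutes insert a A} \<inter> {f. inj_on (orbit f) R}"
    by (auto simp: separated_perms_def)
  also have "\<dots> = (\<lambda>(b, p). transpose a b \<circ> p) ` (insert a A \<times> separated_perms A R {})"
    unfolding permutes_insert by (auto simp: separated_perms_def * image_iff)
  finally show ?thesis .
qed

lemma inj_on_transpose_comp: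
  assumes "a \<notin> A"
  shows "inj_on (\<lambda>(b, p). transpose a b \<circ> p) (B \<times> {p. p permutes A})"
proof (rule inj_onI, clarify)
  fix b p c q
  assume pq: "p permutes A" "q permutes A" and eq: "transpose a b \<circ> p = transpose a c \<circ> q"
  have "p a = a" "q a = a" using pq assms by (simp_all add: permutes_not_in)
  \<comment> \<open>The value at \<open>a\<close> reveals \<open>b\<close>; after that the
    transposition cancels.\<close>
  then have bc: "b = c" using fun_cong[OF eq, of a] by simp
  then have "p = q" using eq by (metis comp_assoc fun.map_id0 id_apply swap_id_idempotent id_comp)
  with bc show "b = c \<and> p = q" by simp
qed

lemma card_separated_perms_insert:
  assumes "finite A" "a \<notin> A" "R \<subseteq> A"
  shows "card (separated_perms (insert a A) R {}) = Suc (card A) * card (separated_perms A R {})"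
proof -
  have "inj_on (\<lambda>(b, p). transpose a b \<circ> p) (insert a A \<times> separated_perms A R {})"
    using inj_on_transpose_comp[OF assms(2), of "insert a A"]
    by (rule inj_on_subset) (auto simp: separated_perms_def)
  then show ?thesis
    using assms by (simp add: separated_perms_insert card_image card_cartesian_product)
qed

text \<open>\<open>f x\<close> lies in the cycle of \<open>x\<close>, so when all elements are
  separated each one is fixed.\<close>

lemma separated_perms_self:
  assumes "finite R"
  shows "separated_perms R R {} = {id}"
proof -
  have "f = id" if f: "f permutes R" "inj_on (orbit f) R" for f
  proof
    fix x
    have pf: "permutation f" using f assms permutation_permutes by blast
    show "f x = id x"
    proof (cases "x \<in> R")
      case True
      then have "f x \<in> R" using f by (simp add: permutes_in_image)
      moreover have "orbit f (f x) = orbit f x" using pf by (rule permutation_orbit_step)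
      ultimately show ?thesis using f True by (simp add: inj_on_def)
    qed (use f in \<open>simp add: permutes_not_in\<close>)
  qed
  moreover have "inj_on (orbit id) R"
    by (metis (mono_tags) id_apply inj_onI orbit_eq_singleton_iff singleton_inject)
  ultimately show ?thesis by (auto simp: separated_perms_def)
qed

text \<open>Starting from the identity on \<open>R\<close>, the \<open>i\<close>-th inserted element
  contributes the factor \<open>card R + i\<close>; the product of these factors is rewritten with a
  binomial by absorption.\<close>

lemma card_separated_perms_no_constraint:
  assumes "finite B" "finite R" "B \<inter> R = {}"
  shows "card (separated_perms (B \<union> R) R {}) = fact (card B) * (card B + card R choose card R)"
  using assms
proof (induction B rule: finite_induct)
  case empty
  then show ?case by (simp add: separated_perms_self)
next
  case (insert a B)
  have "card (separated_perms (insert a B \<union> R) R {}) =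
      Suc (card (B \<union> R)) * card (separated_perms (B \<union> R) R {})"
    using insert card_separated_perms_insert[of "B \<union> R" a R] by simp
  also have "\<dots> = fact (card B) * (Suc (card B + card R) * (card B + card R choose card R))"
    using insert by (simp add: card_Un_disjoint algebra_simps)
  also have "Suc (card B + card R) * (card B + card R choose card R) =
      Suc (card B) * (Suc (card B) + card R choose card R)"
    using binomial_absorb_comp[of "Suc (card B) + card R" "card R"] by simp
  finally show ?case using insert by (simp add: algebra_simps)
qed

section \<open>Forbidding fixed points\<close>

lemma card_separated_perms_insert_fixpoint_free:
  assumes "finite A" "u \<in> A" "u \<notin> U"
  shows "card (separated_perms A R U) =
           card (separated_perms A R (insert u U)) + card (separated_perms (A - {u}) (R - {u}) U)"
proof -
  have perm: "permutation f" if "f permutes A" for f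
    using that assms(1) permutation_permutes by blast
  have inj: "inj_on (orbit f) R \<longleftrightarrow> inj_on (orbit f) (R - {u})" if "f permutes A" "f u = u" for f
  proof -
    have "u \<in> orbit f y \<longleftrightarrow> y = u" "y \<in> orbit f u \<longleftrightarrow> y = u" for y
      using orbit_eq_iff[OF perm[OF that(1)]] orbit_eq_singleton_iff[of f u] that(2) by blast+
    then show ?thesis
      unfolding inj_on_orbit_iff[OF perm[OF that(1)]] by (metis Diff_iff singletonD)
  qed
  have "f permutes A - {u} \<longleftrightarrow> f permutes A \<and> f u = u" for f
    using permutes_subset[of f "A - {u}" A] permutes_superset[of f A "A - {u}"]
    by (auto simp: permutes_not_in)
  \<comment> \<open>Case split on whether \<open>f\<close> fixes \<open>u\<close>; the permutations
    that do are those of \<open>A - {u}\<close>.\<close>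
  then have "separated_perms A R U =
      separated_perms A R (insert u U) \<union> separated_perms (A - {u}) (R - {u}) U"
    using inj by (auto simp: separated_perms_def)
  moreover have "separated_perms A R (insert u U) \<inter> separated_perms (A - {u}) (R - {u}) U = {}"
    by (auto simp: separated_perms_def permutes_not_in)
  ultimately show ?thesis
    using assms(1) by (simp add: card_Un_disjoint finite_separated_perms)
qed

text \<open>Deleting an element of \<open>R\<close> leaves \<open>A - R\<close> alone, so the
  factorial stays and the recurrence for the remaining factor is Pascal's rule.\<close>

lemma card_separated_perms_fixpoint_free_subset:
  assumes "finite U" "finite A" "U \<subseteq> R" "R \<subseteq> A"
  shows "card (separated_perms A R U) = fact (card (A - R)) * (card A - card U choose card R)"
  using assms
proof (induction U arbitrary: A R rule: finite_induct)
  case empty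
  have fR: "finite R" using empty finite_subset by blast
  have "A = (A - R) \<union> R" "card A = card (A - R) + card R"
    using empty fR by (auto simp: card_Diff_subset card_mono)
  then show ?case using card_separated_perms_no_constraint[of "A - R" R] empty fR by auto
next
  case (insert u U)
  have fR: "finite R" using insert.prems(1,3) by (rule finite_subset[rotated])
  have u: "u \<in> A" "u \<in> R" using insert.prems by auto
  have "card (insert u U) \<le> card A" using insert.prems by (intro card_mono) auto
  then have "Suc (card U) \<le> card A" using insert.hyps by simp
  from le_Suc_ex[OF this] obtain m where m: "card A = Suc (card U) + m" by blast
  obtain s where s: "card R = Suc s" using card_Suc_Diff1[OF fR u(2)] by metis
  have "A - {u} - (R - {u}) = A - R" using u by auto
  moreover have "card (separated_perms (A - {u}) (R - {u}) U) =
      fact (card (A - {u} - (R - {u}))) * (card (A - {u}) - card U choose card (R - {u}))"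
    using insert.hyps insert.prems by (intro insert.IH) auto
  ultimately have "card (separated_perms (A - {u}) (R - {u}) U) = fact (card (A - R)) * (m choose s)"
    using insert.prems(1) u fR m s by simp
  moreover have "card (separated_perms A R U) = fact (card (A - R)) * (Suc m choose Suc s)"
    using insert.IH[of A R] insert.prems m s by (simp add: Suc_diff_le)
  ultimately show ?case
    using card_separated_perms_insert_fixpoint_free[of A u U R] insert.hyps insert.prems(1) u m s
    by (simp add: algebra_simps)
qed

text \<open>With \<open>E\<close> the shift of sequences, the sum is \<open>(1 - E)^t a\<close> at
  0, and this is \<open>(1 - E)^(t+1) = (1 - E)^t - (1 - E)^t E\<close>.\<close>

lemma alternating_binomial_sum_Suc:
  fixes a :: "nat \<Rightarrow> int"
  shows "(\<Sum>i\<le>Suc t. (-1)^i * int (Suc t choose i) * a i) =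
    (\<Sum>i\<le>t. (-1)^i * int (t choose i) * a i) - (\<Sum>i\<le>t. (-1)^i * int (t choose i) * a (Suc i))"
proof -
  have pascal: "(-1)^Suc i * int (Suc t choose Suc i) * a (Suc i) =
      (-1)^Suc i * int (t choose Suc i) * a (Suc i) - (-1)^i * int (t choose i) * a (Suc i)" for i
    by (simp add: algebra_simps)
  have "(\<Sum>i\<le>Suc t. (-1)^i * int (Suc t choose i) * a i) =
      a 0 + (\<Sum>i\<le>t. (-1)^Suc i * int (t choose Suc i) * a (Suc i))
          - (\<Sum>i\<le>t. (-1)^i * int (t choose i) * a (Suc i))"
    unfolding sum.atMost_Suc_shift pascal sum_subtractf by simp
  also have "a 0 + (\<Sum>i\<le>t. (-1)^Suc i * int (t choose Suc i) * a (Suc i)) =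
      (\<Sum>i\<le>Suc t. (-1)^i * int (t choose i) * a i)"
    by (simp only: sum.atMost_Suc_shift) simp
  finally show ?thesis by simp
qed

text \<open>Deleting an element outside \<open>R\<close> lowers \<open>card (A - R)\<close> by one
  and keeps \<open>R\<close>. Each new element of \<open>W\<close> thus applies the difference
  \<open>1 - E\<close> once more, starting from the count for \<open>U = R\<close>.\<close>

lemma card_separated_perms_fixpoint_free_superset:
  assumes "finite W" "finite A" "R \<subseteq> A" "W \<subseteq> A - R"
  shows "int (card (separated_perms A R (R \<union> W))) =
    (\<Sum>i\<le>card W. (-1)^i * int (card W choose i) *
       int (fact (card (A - R) - i) * (card (A - R) - i choose card R)))"
  using assms
proof (induction W arbitrary: A rule: finite_induct)
  case empty
  have "finite R" using empty finite_subset by blast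
  then show ?case
    using empty card_separated_perms_fixpoint_free_subset[of R A R] by (simp add: card_Diff_subset)
next
  case (insert u W)
  have u: "u \<in> A" "u \<notin> R" using insert by auto
  have "A - {u} - R = A - R - {u}" by auto
  then have c: "card (A - {u} - R) = card (A - R) - 1" using u insert by simp
  have "int (card (separated_perms (A - {u}) R (R \<union> W))) =
    (\<Sum>i\<le>card W. (-1)^i * int (card W choose i) *
       int (fact (card (A - {u} - R) - i) * (card (A - {u} - R) - i choose card R)))"
    using insert u by (intro insert.IH) auto
  moreover have "R - {u} = R" using u by auto
  ultimately have "int (card (separated_perms (A - {u}) (R - {u}) (R \<union> W))) =
    (\<Sum>i\<le>card W. (-1)^i * int (card W choose i) *
       int (fact (card (A - R) - Suc i) * (card (A - R) - Suc i choose card R)))"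
    by (simp only: c diff_diff_left plus_1_eq_Suc)
  moreover have "int (card (separated_perms A R (R \<union> W))) =
    (\<Sum>i\<le>card W. (-1)^i * int (card W choose i) *
       int (fact (card (A - R) - i) * (card (A - R) - i choose card R)))"
    using insert.prems by (intro insert.IH) auto
  moreover have "card (separated_perms A R (R \<union> W)) =
    card (separated_perms A R (R \<union> insert u W)) +
    card (separated_perms (A - {u}) (R - {u}) (R \<union> W))"
    using card_separated_perms_insert_fixpoint_free[of A u "R \<union> W" R] insert.hyps insert.prems u
    by simp
  ultimately show ?case
    unfolding card_insert_disjoint[OF insert.hyps] alternating_binomial_sum_Suc by linarith
qed

lemma r_derangement_number_eq:
  "int (r_derangement_number r n) =
     (\<Sum>i\<le>n. (-1)^i * int (n choose i) * int (fact (n - i) * (n - i choose r)))"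
proof -
  let ?A = "{1..n + r}" and ?R = "{1..r}"
  have "?R \<union> (?A - ?R) = ?A" by auto
  moreover have "card (?A - ?R) = n" by (subst card_Diff_subset) auto
  ultimately show ?thesis
    using card_separated_perms_fixpoint_free_superset[of "?A - ?R" ?A ?R]
    by (simp add: r_derangement_number_def r_derangements_def separated_perms_def)
qed

subsection \<open>The polynomial behind the signed sequence\<close>

definition ffact :: "nat \<Rightarrow> int \<Rightarrow> int" where
  "ffact i x = (\<Prod>j<i. x - int j)"

lemma ffact_mult_fact: "i \<le> m \<Longrightarrow> ffact i (int m) * fact (m - i) = fact m"
proof (induction i)
  case (Suc i)
  have "m - i = Suc (m - Suc i)" using Suc by simp
  then have "(fact (m - i) :: int) = (int m - int i) * fact (m - Suc i)"
    using Suc by simp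
  then have "ffact (Suc i) (int m) * fact (m - Suc i) = ffact i (int m) * fact (m - i)"
    by (simp add: ffact_def)
  then show ?case using Suc by simp
qed (simp add: ffact_def)

lemma ffact_eq_0: "m < i \<Longrightarrow> ffact i (int m) = 0"
  unfolding ffact_def by (intro prod_zero) auto

text \<open>The cutoff \<open>M\<close> does not depend on \<open>x\<close>, which makes this a
  polynomial in \<open>x\<close>; at a natural number up to \<open>M\<close> the falling factorials
  truncate the sum by themselves.\<close>

definition C_sum :: "nat \<Rightarrow> nat \<Rightarrow> int \<Rightarrow> int" where
  "C_sum r M x = (\<Sum>i\<le>M. (-1)^i * int (i + r choose r) * ffact i x)"

lemma C_num_eq:
  assumes "m \<le> M"
  shows "C_num r (r + m) = (-1)^m * C_sum r M (int m)"
proof -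
  let ?n = "r + m"
  have "fact m * int (r_derangement_number r ?n) = fact ?n * ((-1)^m * C_sum r m (int m))"
  proof -
    have "fact m * int (r_derangement_number r ?n) =
        (\<Sum>i\<le>?n. fact m * ((-1)^i * int (?n choose i) * int (fact (?n - i) * (?n - i choose r))))"
      by (simp add: r_derangement_number_eq sum_distrib_left)
    \<comment> \<open>For \<open>i > m\<close> the factor \<open>?n - i choose r\<close>
      vanishes.\<close>
    also have "\<dots> =
        (\<Sum>i\<le>m. fact m * ((-1)^i * int (?n choose i) * int (fact (?n - i) * (?n - i choose r))))"
      by (rule sum.mono_neutral_right) auto
    \<comment> \<open>Two cancellations: \<open>(?n choose i) (?n - i)!\<close> is
      \<open>?n! / i!\<close>, and \<open>m! / i!\<close> is a falling factorial of length
      \<open>m - i\<close>. Pulling out \<open>fact ?n\<close> shows that the division in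
      \<open>C_num\<close> is exact.\<close>
    also have "\<dots> = (\<Sum>i\<le>m. fact ?n * ((-1)^m * ((-1)^(m - i) *
        int (m - i + r choose r) * ffact (m - i) (int m))))"
    proof (rule sum.cong[OF refl])
      fix i assume "i \<in> {..m}"
      then have i: "i \<le> m" by simp
      have f: "ffact (m - i) (int m) * fact i = fact m" using ffact_mult_fact[of "m - i" m] i by simp
      have "fact i * fact (?n - i) * (?n choose i) = (fact ?n :: nat)"
        using i by (intro binomial_fact_lemma) simp
      then have g: "fact i * fact (?n - i) * int (?n choose i) = fact ?n"
        by (metis of_nat_fact of_nat_mult)
      have s: "(-1)^m * (-1)^(m - i) = ((-1)^i :: int)"
        using i by (simp flip: power_add add: minus_one_power_iff)
      have e: "?n - i = m - i + r" using i by simp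
      have "fact m * ((-1)^i * int (?n choose i) * int (fact (?n - i) * (?n - i choose r))) =
        ffact (m - i) (int m) * (-1)^i * int (?n - i choose r) *
          (fact i * fact (?n - i) * int (?n choose i))"
        unfolding f[symmetric] by (simp add: algebra_simps)
      also have "\<dots> = fact ?n * (((-1)^m * (-1)^(m - i)) *
        int (m - i + r choose r) * ffact (m - i) (int m))"
        unfolding g unfolding s e by (simp add: algebra_simps)
      finally show "fact m * ((-1)^i * int (?n choose i) * int (fact (?n - i) * (?n - i choose r))) =
        fact ?n * ((-1)^m * ((-1)^(m - i) * int (m - i + r choose r) * ffact (m - i) (int m)))"
        by (simp add: algebra_simps)
    qed
    also have "\<dots> = (\<Sum>i\<le>m. fact ?n * ((-1)^m * ((-1)^i * int (i + r choose r) * ffact i (int m))))"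
      by (rule sum.nat_diff_reindex[where n = "Suc m", unfolded lessThan_Suc_atMost, simplified])
    finally show ?thesis by (simp add: C_sum_def sum_distrib_left)
  qed
  moreover have "C_sum r m (int m) = C_sum r M (int m)"
    unfolding C_sum_def using assms by (intro sum.mono_neutral_left) (auto simp: ffact_eq_0)
  ultimately show ?thesis by (simp add: C_num_def)
qed

section \<open>Second-order expansions\<close>

lemma C_sum_add:
  "\<exists>d. \<forall>h. \<exists>e. C_sum r M (x + h) = C_sum r M x + h * d + h\<^sup>2 * e"
proof -
  \<comment> \<open>Integral Taylor expansion at \<open>x\<close>: one slope \<open>d\<close> serves
    every \<open>h\<close>, and only the remainder \<open>e\<close> varies with \<open>h\<close>.
    The property holds for linear factors and passes to products and sums, hence to
    \<open>C_sum\<close>.\<close>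
  define expandable where
    "expandable f \<longleftrightarrow> (\<exists>d. \<forall>h. \<exists>e. f (x + h) = f x + h * d + h\<^sup>2 * e)" for f :: "int \<Rightarrow> int"
  have const: "expandable (\<lambda>_. c)" for c
    unfolding expandable_def by (intro exI[of _ 0] allI) simp
  have linear: "expandable (\<lambda>y. y - c)" for c
    unfolding expandable_def by (intro exI[of _ 1] allI exI[of _ 0]) simp
  have mult: "expandable (\<lambda>y. f y * g y)" if "expandable f" "expandable g" for f g
  proof -
    obtain d d' where d: "\<forall>h. \<exists>e. f (x + h) = f x + h * d + h\<^sup>2 * e"
      "\<forall>h. \<exists>e. g (x + h) = g x + h * d' + h\<^sup>2 * e"
      using \<open>expandable f\<close> \<open>expandable g\<close> unfolding expandable_def by blast
    have "\<exists>e. f (x + h) * g (x + h) = f x * g x + h * (f x * d' + d * g x) + h\<^sup>2 * e" for h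
    proof -
      obtain e e' where "f (x + h) = f x + h * d + h\<^sup>2 * e" "g (x + h) = g x + h * d' + h\<^sup>2 * e'"
        using d by blast
      then have "f (x + h) * g (x + h) = f x * g x + h * (f x * d' + d * g x) +
          h\<^sup>2 * (f x * e' + d * d' + e * g x + h * (d * e' + e * d') + h\<^sup>2 * e * e')"
        by (simp add: algebra_simps power2_eq_square)
      then show ?thesis by blast
    qed
    then show ?thesis unfolding expandable_def by blast
  qed
  have add: "expandable (\<lambda>y. f y + g y)" if "expandable f" "expandable g" for f g
  proof -
    obtain d d' where d: "\<forall>h. \<exists>e. f (x + h) = f x + h * d + h\<^sup>2 * e"
      "\<forall>h. \<exists>e. g (x + h) = g x + h * d' + h\<^sup>2 * e"
      using \<open>expandable f\<close> \<open>expandable g\<close> unfolding expandable_def by blast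
    have "\<exists>e. f (x + h) + g (x + h) = f x + g x + h * (d + d') + h\<^sup>2 * e" for h
    proof -
      obtain e e' where "f (x + h) = f x + h * d + h\<^sup>2 * e" "g (x + h) = g x + h * d' + h\<^sup>2 * e'"
        using d by blast
      then have "f (x + h) + g (x + h) = f x + g x + h * (d + d') + h\<^sup>2 * (e + e')"
        by (simp add: algebra_simps)
      then show ?thesis by blast
    qed
    then show ?thesis unfolding expandable_def by blast
  qed
  have "expandable (ffact i)" for i
    unfolding ffact_def by (induction i) (simp_all add: const mult linear)
  then have "expandable (\<lambda>y. \<Sum>i\<le>M. c i * ffact i y)" for c
    by (induction M) (simp_all add: const mult add)
  then have "expandable (C_sum r M)"
    unfolding C_sum_def .
  then show ?thesis unfolding expandable_def .
qed

text \<open>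
  Both congruences involve only values of \<^term>\<open>C_sum r M\<close>, which at a natural number are
  independent of large \<open>M\<close>; the derivative is not.
\<close>
lemma C_sum_difference_quotient:
  fixes p x y :: int
  assumes "k \<ge> 1" and "p ^ k dvd y - x"
  shows "[p * (C_sum r M y - C_sum r M x) = (y - x) * (C_sum r M (x + p) - C_sum r M x)] (mod p ^ (k + 2))"
    and "[C_sum r M (y + p) - C_sum r M y = C_sum r M (x + p) - C_sum r M x] (mod p\<^sup>2)"
proof -
  let ?f = "C_sum r M"
  obtain k' where k': "k = Suc k'" using assms(1) by (cases k) auto
  obtain s where s: "y - x = p ^ k * s" using assms(2) by blast
  obtain d where d: "\<forall>h. \<exists>e. ?f (x + h) = ?f x + h * d + h\<^sup>2 * e" using C_sum_add by blast
  obtain e where e: "?f (x + (y - x)) = ?f x + (y - x) * d + (y - x)\<^sup>2 * e" using d by blast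
  obtain e' where e': "?f (x + p) = ?f x + p * d + p\<^sup>2 * e'" using d by blast
  \<comment> \<open>Expanding every value at \<open>x\<close>, also the one at \<open>y + p\<close>,
    keeps a single slope \<open>d\<close>.\<close>
  obtain e'' where e'': "?f (x + (y - x + p)) = ?f x + (y - x + p) * d + (y - x + p)\<^sup>2 * e''"
    using d by blast
  have diff: "?f y - ?f x = (y - x) * d + (y - x)\<^sup>2 * e" "?f (x + p) - ?f x = p * d + p\<^sup>2 * e'"
    using e e' by simp_all
  \<comment> \<open>The terms with \<open>d\<close> cancel. What remains contains
    \<open>p (y - x)^2\<close>, divisible by \<open>p^(2k+1)\<close> and so by
    \<open>p^(k+2)\<close> as \<open>k \<ge> 1\<close>, and \<open>(y - x) p^2\<close>.\<close>
  have "p * (?f y - ?f x) - (y - x) * (?f (x + p) - ?f x) =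
      p * (y - x)\<^sup>2 * e - (y - x) * p\<^sup>2 * e'"
    unfolding diff by (simp add: algebra_simps)
  also have "\<dots> = p ^ (k + 2) * (p ^ k' * s\<^sup>2 * e - s * e')"
    unfolding s k' by (simp add: algebra_simps power2_eq_square)
  finally show "[p * (?f y - ?f x) = (y - x) * (?f (x + p) - ?f x)] (mod p ^ (k + 2))"
    by (simp add: cong_iff_dvd_diff)
  \<comment> \<open>Again \<open>d\<close> cancels, and \<open>p\<close> divides the base of each
    remaining square because \<open>k \<ge> 1\<close>.\<close>
  have "?f (y + p) - ?f y - (?f (x + p) - ?f x) =
      (y - x + p)\<^sup>2 * e'' - (y - x)\<^sup>2 * e - p\<^sup>2 * e'"
    using e e' e'' by (simp add: algebra_simps)
  also have "\<dots> = p\<^sup>2 * ((p ^ k' * s + 1)\<^sup>2 * e'' - (p ^ k' * s)\<^sup>2 * e - e')"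
    unfolding s k' by (simp add: algebra_simps power2_eq_square)
  finally show "[?f (y + p) - ?f y = ?f (x + p) - ?f x] (mod p\<^sup>2)"
    by (simp add: cong_iff_dvd_diff)
qed

text \<open>The signs make both sequences agree with polynomials on bounded ranges.\<close>
definition signed_C :: "nat \<Rightarrow> nat \<Rightarrow> int" where
  "signed_C r n = (-1) ^ (n - r) * C_num r n"

definition signed_q :: "nat \<Rightarrow> nat \<Rightarrow> nat \<Rightarrow> int" where
  "signed_q r p n = (-1) ^ (n - r) * q_hat r p n"

lemma signed_C_eq:
  assumes "n \<ge> r" "n \<le> M"
  shows "signed_C r n = C_sum r M (int n - int r)"
proof -
  have "C_num r n = (-1) ^ (n - r) * C_sum r M (int (n - r))"
    using C_num_eq[of "n - r" M r] assms by simp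
  then show ?thesis using assms by (simp add: signed_C_def flip: power_add mult.assoc)
qed

text \<open>The factor \<open>(-1)^p\<close> in \<open>q_hat\<close> offsets the change of sign
  between \<open>n\<close> and \<open>n + p\<close>. The expansion with increment \<open>p\<close>
  makes the difference a multiple of \<open>p\<close>, so the division is exact.\<close>

lemma signed_q_mult:
  assumes "n \<ge> r" "p > 0"
  shows "int p * signed_q r p n = signed_C r (n + p) - signed_C r n"
proof -
  have eq: "(-1) ^ p * C_num r (n + p) - C_num r n =
      (-1) ^ (n - r) * (signed_C r (n + p) - signed_C r n)"
    using assms(1) by (simp add: signed_C_def algebra_simps flip: power_add mult.assoc)
      (simp add: Nat.diff_add_assoc2 power_add minus_one_power_iff)
  define M where "M = n + p"
  obtain d where "\<forall>h. \<exists>e. C_sum r M (int n - int r + h) = C_sum r M (int n - int r) + h * d + h\<^sup>2 * e"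
    using C_sum_add by blast
  then obtain e where "C_sum r M (int n - int r + int p) =
      C_sum r M (int n - int r) + int p * d + (int p)\<^sup>2 * e" by blast
  moreover have "signed_C r n = C_sum r M (int n - int r)"
    "signed_C r (n + p) = C_sum r M (int n - int r + int p)"
    using assms signed_C_eq[of r n M] signed_C_eq[of r "n + p" M] by (simp_all add: M_def algebra_simps)
  ultimately have "signed_C r (n + p) - signed_C r n = int p * (d + int p * e)"
    by (simp add: algebra_simps power2_eq_square)
  then have "int p dvd (-1) ^ p * C_num r (n + p) - C_num r n" unfolding eq by simp
  then have "int p * q_hat r p n = (-1) ^ p * C_num r (n + p) - C_num r n"
    unfolding q_hat_def by simp
  moreover have "int p * signed_q r p n = (-1) ^ (n - r) * (int p * q_hat r p n)"
    by (simp add: signed_q_def)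
  ultimately have "int p * signed_q r p n =
      (-1) ^ (n - r) * ((-1) ^ (n - r) * (signed_C r (n + p) - signed_C r n))"
    by (simp only: eq)
  then show ?thesis by (simp flip: power_add mult.assoc)
qed

text \<open>The Hensel congruence for the sequence: \<open>signed_q\<close> plays the derivative,
  and modulo \<open>p\<close> it depends only on the class of its argument.\<close>

lemma signed_C_cong:
  assumes "k \<ge> 1" "p > 0" "n \<ge> r" "m \<ge> r" "[int m = int n] (mod int p ^ k)"
  shows "[signed_C r m = signed_C r n + (int m - int n) * signed_q r p n] (mod int p ^ (k + 1))"
    and "[signed_q r p m = signed_q r p n] (mod int p)"
proof -
  \<comment> \<open>One cutoff large enough for all four arguments, so that a single polynomial is
    involved.\<close>
  define M where "M = m + n + p"
  have C: "C_sum r M (int m - int r) = signed_C r m" "C_sum r M (int n - int r) = signed_C r n"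
    "C_sum r M (int m - int r + int p) = signed_C r (m + p)"
    "C_sum r M (int n - int r + int p) = signed_C r (n + p)"
    using assms signed_C_eq[of r m M] signed_C_eq[of r n M] signed_C_eq[of r "m + p" M]
      signed_C_eq[of r "n + p" M] by (simp_all add: M_def algebra_simps)
  have "int p ^ k dvd (int m - int r) - (int n - int r)"
    using assms(5) by (simp add: cong_iff_dvd_diff)
  note D = C_sum_difference_quotient[OF assms(1) this, of r M, unfolded C,
    folded signed_q_mult[OF assms(3,2)] signed_q_mult[OF assms(4,2)]]
  \<comment> \<open>Both differences carry a factor \<open>p\<close>; cancelling it lowers the
    moduli \<open>p^(k+2)\<close> and \<open>p^2\<close> by one power.\<close>
  have "int p * int p ^ (k + 1) dvd
      int p * (signed_C r m - (signed_C r n + (int m - int n) * signed_q r p n))"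
    using D(1) by (simp add: cong_iff_dvd_diff algebra_simps)
  then show "[signed_C r m = signed_C r n + (int m - int n) * signed_q r p n] (mod int p ^ (k + 1))"
    using assms(2) by (simp add: cong_iff_dvd_diff)
  have "int p * int p dvd int p * (signed_q r p m - signed_q r p n)"
    using D(2) by (simp add: cong_iff_dvd_diff algebra_simps power2_eq_square)
  then show "[signed_q r p m = signed_q r p n] (mod int p)"
    using assms(2) by (simp add: cong_iff_dvd_diff)
qed

subsection \<open>Lifting residue classes\<close>

lemma dvd_minus_one_power_mult_iff:
  fixes a b :: int
  shows "a dvd (-1) ^ i * b \<longleftrightarrow> a dvd b"
  by (cases "even i") simp_all

lemma dvd_signed_C_iff: "a dvd signed_C r n \<longleftrightarrow> a dvd C_num r n"
  by (simp only: signed_C_def dvd_minus_one_power_mult_iff)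

lemma dvd_signed_q_iff: "a dvd signed_q r p n \<longleftrightarrow> a dvd q_hat r p n"
  by (simp only: signed_q_def dvd_minus_one_power_mult_iff)

section \<open>Valuations, modular quotients and residue classes\<close>

lemma padic_val_ge_iff:
  assumes "prime p"
  shows "padic_val p x \<ge> enat l \<longleftrightarrow> int p ^ l dvd x"
proof -
  have "\<not> is_unit (int p)" using assms not_prime_unit[of "int p"] by auto
  \<comment> \<open>At \<open>x = 0\<close> every power divides, in agreement with the value
    \<open>\<infinity>\<close>.\<close>
  then show ?thesis using power_dvd_iff_le_multiplicity[of x "int p" l] by (auto simp: padic_val_def)
qed

lemma padic_val_pos_iff: "prime p \<Longrightarrow> padic_val p x > 0 \<longleftrightarrow> int p dvd x"
  using padic_val_ge_iff[of p 1 x] by (cases "padic_val p x") (auto simp: zero_enat_def)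

lemma padic_val_eq_0_iff: "prime p \<Longrightarrow> padic_val p x = 0 \<longleftrightarrow> \<not> int p dvd x"
  using padic_val_pos_iff[of p x] by auto

text \<open>Clears the denominator of a Newton step: \<open>b\<close> is a unit modulo
  \<open>m\<close>, so multiplying by it is reversible.\<close>

lemma cong_mod_quot_iff:
  fixes a b m x y :: int
  assumes "coprime b m"
  shows "[x = y - mod_quot m a b] (mod m) \<longleftrightarrow> [a + (x - y) * b = 0] (mod m)"
proof -
  have "[mod_quot m a b * b = a] (mod m)"
    using cong_scalar_left[OF cong_modular_inverse2[OF assms], of a]
    by (simp add: mod_quot_def mult.assoc)
  then have *: "[(x - y) * b + mod_quot m a b * b = (x - y) * b + a] (mod m)"
    by (rule cong_add[OF cong_refl])
  have "[x = y - mod_quot m a b] (mod m) \<longleftrightarrow> [x - y + mod_quot m a b = 0] (mod m)"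
    by (simp add: cong_iff_dvd_diff algebra_simps)
  also have "\<dots> \<longleftrightarrow> [(x - y + mod_quot m a b) * b = 0 * b] (mod m)"
    using assms by (simp only: cong_mult_rcancel)
  also have "\<dots> \<longleftrightarrow> [a + (x - y) * b = 0] (mod m)"
    using * by (simp add: distrib_right add.commute) (meson cong_sym cong_trans)
  finally show ?thesis .
qed

lemma exists_nat_ge_cong:
  fixes m :: int
  assumes "m > 0"
  obtains n where "n \<ge> r" "[int n = x] (mod m)"
proof
  \<comment> \<open>Adding \<open>r\<close> full periods to the least residue reaches
    \<open>r\<close>, since \<open>m\<close> is at least 1.\<close>
  define n where "n = nat (x mod m) + r * nat m"
  have "r * 1 \<le> r * nat m" using assms by (intro mult_le_mono2) linarith
  then show "n \<ge> r" unfolding n_def by linarith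
  have "int n = x mod m + int r * m" using assms by (simp add: n_def)
  then show "[int n = x] (mod m)" by (simp add: cong_def)
qed

text \<open>Carries a criterion for natural numbers \<open>n \<ge> r\<close> over to integer
  classes. Every class has a member \<open>\<ge> r\<close>, so the universal condition on
  \<open>P\<close> is never vacuous.\<close>

lemma cong_class_iff:
  fixes m :: int
  assumes "m > 0" and P: "\<And>n. n \<ge> r \<Longrightarrow> Q (int n) \<and> P n \<longleftrightarrow> [int n = x0] (mod m)"
    and Q: "\<And>x y. [x = y] (mod m) \<Longrightarrow> Q x \<longleftrightarrow> Q y"
  shows "Q x \<and> (\<forall>n\<ge>r. [int n = x] (mod m) \<longrightarrow> P n) \<longleftrightarrow> [x = x0] (mod m)"
proof -
  obtain n where n: "n \<ge> r" "[int n = x] (mod m)" using exists_nat_ge_cong[OF assms(1)] .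
  show ?thesis
  proof
    assume "Q x \<and> (\<forall>n\<ge>r. [int n = x] (mod m) \<longrightarrow> P n)"
    then have "[int n = x0] (mod m)" using P[OF n(1)] Q[OF n(2)] n by blast
    then show "[x = x0] (mod m)" using n cong_sym cong_trans by blast
  next
    assume x: "[x = x0] (mod m)"
    then have "[int n = x0] (mod m)" using n cong_trans by blast
    then have "Q x" using P[OF n(1)] Q[OF n(2)] by blast
    then show "Q x \<and> (\<forall>n\<ge>r. [int n = x] (mod m) \<longrightarrow> P n)" using P x cong_trans by blast
  qed
qed

section \<open>Hensel lifting\<close>

lemma q_hat_cong:
  assumes "p > 0" "n \<ge> r" "m \<ge> r" "[int m = int n] (mod int p)"
  shows "[(-1) ^ (n + m) * q_hat r p n = q_hat r p m] (mod int p)"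
proof -
  have "[signed_q r p n = signed_q r p m] (mod int p)"
    using signed_C_cong(2)[of 1 p r n m] assms by (simp add: cong_sym)
  then have "[(-1) ^ (m - r) * signed_q r p n = (-1) ^ (m - r) * signed_q r p m] (mod int p)"
    by (rule cong_scalar_left)
  \<comment> \<open>The two shifts by \<open>r\<close> cancel in parity; this is the origin of the
    sign in the recursion for \<open>n_l\<close>.\<close>
  moreover have "(-1) ^ (m - r) * (-1) ^ (n - r) = ((-1) ^ (n + m) :: int)"
    using assms(2,3) by (simp add: minus_one_power_iff)
  ultimately show ?thesis by (simp add: signed_q_def flip: power_add mult.assoc)
qed

text \<open>The linear congruence of Hensel's lemma. Its slope is multiplied by
  \<open>n - nk\<close>, a multiple of \<open>p^k\<close>, so any \<open>b\<close> congruent to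
  \<open>q_hat\<close> modulo \<open>p\<close> serves; this covers the slope taken at
  \<open>n1\<close> as well.\<close>

lemma dvd_C_num_lift_iff:
  assumes "prime p" "k \<ge> 1" "nk \<ge> r" "int p ^ k dvd C_num r nk" "n \<ge> r"
    and b: "[b = q_hat r p nk] (mod int p)" and "\<not> int p dvd b"
  shows "[int n = int nk] (mod int p ^ k) \<and> int p ^ (k + 1) dvd C_num r n \<longleftrightarrow>
    [int n = int nk - mod_quot (int p ^ (k + 1)) (C_num r nk) b] (mod int p ^ (k + 1))"
proof -
  let ?m = "int p ^ (k + 1)" and ?c = "C_num r nk" and ?s = "(-1) ^ (nk - r) :: int"
  have p0: "p > 0" using assms(1) prime_gt_0_nat by blast
  have cop: "coprime b (int p)"
    using prime_imp_coprime[of "int p" b] assms by (simp add: coprime_commute)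
  have "[int n = int nk - mod_quot ?m ?c b] (mod ?m) \<longleftrightarrow> [?c + (int n - int nk) * b = 0] (mod ?m)"
    using cop by (intro cong_mod_quot_iff) simp
  \<comment> \<open>The added conjunct is implied: \<open>p^k\<close> divides \<open>?c\<close>,
    hence \<open>(n - nk) b\<close>, and \<open>b\<close> is prime to \<open>p\<close>.\<close>
  also have "\<dots> \<longleftrightarrow> [int n = int nk] (mod int p ^ k) \<and> [?c + (int n - int nk) * b = 0] (mod ?m)"
  proof -
    have "[int n = int nk] (mod int p ^ k)" if "[?c + (int n - int nk) * b = 0] (mod ?m)"
    proof -
      have "int p ^ k dvd ?c + (int n - int nk) * b"
        using that by (metis cong_0_iff le_add1 le_imp_power_dvd dvd_trans)
      then have "int p ^ k dvd (int n - int nk) * b" using assms(4) by (simp add: dvd_add_right_iff)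
      then show ?thesis using cop by (simp add: coprime_dvd_mult_left_iff coprime_commute cong_iff_dvd_diff)
    qed
    then show ?thesis by blast
  qed
  also have "\<dots> \<longleftrightarrow> [int n = int nk] (mod int p ^ k) \<and> ?m dvd C_num r n"
  proof (intro conj_cong refl)
    assume nk: "[int n = int nk] (mod int p ^ k)"
    have "int p ^ k * int p dvd (int n - int nk) * (b - q_hat r p nk)"
      using nk b by (intro mult_dvd_mono) (simp_all add: cong_iff_dvd_diff)
    then have "[?c + (int n - int nk) * b = ?c + (int n - int nk) * q_hat r p nk] (mod ?m)"
      by (simp add: cong_iff_dvd_diff algebra_simps)
    then have "[?c + (int n - int nk) * b = 0] (mod ?m) \<longleftrightarrow>
        ?m dvd ?c + (int n - int nk) * q_hat r p nk"
      by (metis cong_0_iff cong_dvd_iff)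
    \<comment> \<open>The common sign turns the expression into the expansion of
      \<open>signed_C\<close>.\<close>
    also have "\<dots> \<longleftrightarrow> ?m dvd ?s * (?c + (int n - int nk) * q_hat r p nk)"
      by (simp only: dvd_minus_one_power_mult_iff)
    also have "?s * (?c + (int n - int nk) * q_hat r p nk) =
        signed_C r nk + (int n - int nk) * signed_q r p nk"
      by (simp add: signed_C_def signed_q_def algebra_simps)
    also have "?m dvd \<dots> \<longleftrightarrow> ?m dvd signed_C r n"
      using signed_C_cong(1)[OF assms(2) p0 assms(3,5) nk] cong_dvd_iff by metis
    finally show "[?c + (int n - int nk) * b = 0] (mod ?m) \<longleftrightarrow> ?m dvd C_num r n"
      by (simp only: dvd_signed_C_iff)
  qed
  finally show ?thesis by blast
qed

text \<open>The linear term is now divisible by \<open>p^(k+1)\<close>, so \<open>signed_C\<close>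
  is constant modulo \<open>p^(k+1)\<close> on the class of \<open>nk\<close>.\<close>

lemma dvd_C_num_iff_of_dvd_q_hat:
  assumes "p > 0" "k \<ge> 1" "nk \<ge> r" "n \<ge> r" "int p dvd q_hat r p nk"
    and nk: "[int n = int nk] (mod int p ^ k)"
  shows "int p ^ (k + 1) dvd C_num r n \<longleftrightarrow> int p ^ (k + 1) dvd C_num r nk"
proof -
  have "int p ^ k * int p dvd (int n - int nk) * signed_q r p nk"
    using nk assms(5) by (intro mult_dvd_mono) (simp_all add: cong_iff_dvd_diff dvd_signed_q_iff)
  then have "[signed_C r nk + (int n - int nk) * signed_q r p nk = signed_C r nk] (mod int p ^ (k + 1))"
    by (simp add: cong_iff_dvd_diff mult.commute)
  then have "[signed_C r n = signed_C r nk] (mod int p ^ (k + 1))"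
    using signed_C_cong(1)[OF assms(2,1,3,4) nk] cong_trans by blast
  then show ?thesis using cong_dvd_iff dvd_signed_C_iff by metis
qed

text \<open>Induction on \<open>l\<close>: inside the class of \<open>n1\<close> the solutions
  modulo \<open>p^l\<close> form one class, which the lifting criterion refines to one class modulo
  \<open>p^(l+1)\<close>.\<close>

lemma dvd_C_num_class:
  assumes "prime p" "n1 \<ge> r" "int p dvd C_num r n1" "\<not> int p dvd q_hat r p n1" "l \<ge> 1"
  shows "\<exists>N\<ge>r. \<forall>n\<ge>r. [int n = int n1] (mod int p) \<and> int p ^ l dvd C_num r n \<longleftrightarrow>
    [int n = int N] (mod int p ^ l)"
  using assms(5)
proof (induction l rule: dec_induct)
  case base
  have p0: "p > 0" using assms(1) prime_gt_0_nat by blast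
  have "int p dvd C_num r n" if "n \<ge> r" "[int n = int n1] (mod int p)" for n
  proof -
    \<comment> \<open>Reduced modulo \<open>p\<close>, the expansion with \<open>k = 1\<close> makes
      the whole class of \<open>n1\<close> solve the case \<open>l = 1\<close>.\<close>
    have "[signed_C r n = signed_C r n1 + (int n - int n1) * signed_q r p n1] (mod int p ^ (1 + 1))"
      using that p0 assms(2) by (intro signed_C_cong) simp_all
    then have "[signed_C r n = signed_C r n1 + (int n - int n1) * signed_q r p n1] (mod int p)"
      by (rule cong_dvd_modulus) simp
    moreover have "int p dvd signed_C r n1 + (int n - int n1) * signed_q r p n1"
      using that assms(3) by (simp add: dvd_signed_C_iff cong_iff_dvd_diff)
    ultimately show ?thesis using cong_dvd_iff dvd_signed_C_iff by metis
  qed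
  then show ?case using assms(2) by auto
next
  case (step l)
  have p0: "p > 0" using assms(1) prime_gt_0_nat by blast
  obtain N where N: "N \<ge> r" and iff: "\<And>n. n \<ge> r \<Longrightarrow>
      [int n = int n1] (mod int p) \<and> int p ^ l dvd C_num r n \<longleftrightarrow> [int n = int N] (mod int p ^ l)"
    using step.IH by blast
  have N1: "[int N = int n1] (mod int p)" "int p ^ l dvd C_num r N" using iff[OF N] by auto
  \<comment> \<open>The slope stays prime to \<open>p\<close> along the class of \<open>n1\<close>,
    so lifting can continue from \<open>N\<close>.\<close>
  have "\<not> int p dvd q_hat r p N"
    using q_hat_cong[OF p0 assms(2) N N1(1)] assms(4)
      cong_dvd_iff dvd_minus_one_power_mult_iff by metis
  then have lift: "[int n = int N] (mod int p ^ l) \<and> int p ^ (l + 1) dvd C_num r n \<longleftrightarrow>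
      [int n = int N - mod_quot (int p ^ (l + 1)) (C_num r N) (q_hat r p N)] (mod int p ^ (l + 1))"
    if "n \<ge> r" for n
    using dvd_C_num_lift_iff[OF assms(1) step.hyps(1) N N1(2) that cong_refl] by simp
  obtain N' where N': "N' \<ge> r" and
    eq: "[int N' = int N - mod_quot (int p ^ (l + 1)) (C_num r N) (q_hat r p N)] (mod int p ^ (l + 1))"
    using exists_nat_ge_cong[of "int p ^ (l + 1)"] p0 by auto
  have "[int n = int n1] (mod int p) \<and> int p ^ Suc l dvd C_num r n \<longleftrightarrow> [int n = int N'] (mod int p ^ Suc l)"
    if "n \<ge> r" for n
  proof -
    have "int p ^ l dvd C_num r n" if "int p ^ Suc l dvd C_num r n"
      using that by (rule power_le_dvd) simp
    then have "[int n = int n1] (mod int p) \<and> int p ^ Suc l dvd C_num r n \<longleftrightarrow>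
        [int n = int N] (mod int p ^ l) \<and> int p ^ (l + 1) dvd C_num r n"
      using iff[OF that] by auto
    also have "\<dots> \<longleftrightarrow> [int n = int N'] (mod int p ^ Suc l)"
      using lift[OF that] eq by (metis Suc_eq_plus1 cong_sym cong_trans)
    finally show ?thesis .
  qed
  then show ?case using N' by blast
qed

theorem corollary16:
  fixes r p :: nat
  assumes "r \<ge> 1" and "prime p"
  shows
    "(\<forall>k nk :: nat. k \<ge> 1 \<longrightarrow> nk \<ge> r \<longrightarrow> int p ^ k dvd C_num r nk \<longrightarrow>
       (padic_val p (q_hat r p nk) = 0 \<longrightarrow>
          ex1_mod (int p ^ (k + 1))
            (\<lambda>x. [x = int nk] (mod int p ^ k) \<and>
                 (\<forall>n\<ge>r. [int n = x] (mod int p ^ (k + 1)) \<longrightarrow> int p ^ (k + 1) dvd C_num r n)) \<and>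
          (\<forall>x. [x = int nk] (mod int p ^ k) \<and>
               (\<forall>n\<ge>r. [int n = x] (mod int p ^ (k + 1)) \<longrightarrow> int p ^ (k + 1) dvd C_num r n) \<longrightarrow>
             [x = int nk - mod_quot (int p ^ (k + 1)) (C_num r nk) (q_hat r p nk)]
               (mod int p ^ (k + 1)))) \<and>
       (padic_val p (q_hat r p nk) > 0 \<longrightarrow> int p ^ (k + 1) dvd C_num r nk \<longrightarrow>
          (\<forall>n\<ge>r. [int n = int nk] (mod int p ^ k) \<longrightarrow> int p ^ (k + 1) dvd C_num r n)) \<and>
       (padic_val p (q_hat r p nk) > 0 \<longrightarrow> \<not> int p ^ (k + 1) dvd C_num r nk \<longrightarrow>
          (\<forall>n\<ge>r. [int n = int nk] (mod int p ^ k) \<longrightarrow> \<not> int p ^ (k + 1) dvd C_num r n)))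
     \<and>
     (\<forall>n1 :: nat. n1 \<ge> r \<longrightarrow> int p dvd C_num r n1 \<longrightarrow> padic_val p (q_hat r p n1) = 0 \<longrightarrow>
       (\<forall>l :: nat. l \<ge> 1 \<longrightarrow>
          ex1_mod (int p ^ l)
            (\<lambda>x. [x = int n1] (mod int p) \<and>
                 (\<forall>n\<ge>r. [int n = x] (mod int p ^ l) \<longrightarrow> padic_val p (C_num r n) \<ge> enat l))) \<and>
       (\<forall>N :: nat \<Rightarrow> nat.
          N 1 = n1 \<longrightarrow>
          (\<forall>l\<ge>1. N l \<ge> r \<and> [int (N l) = int n1] (mod int p) \<and>
                 (\<forall>n\<ge>r. [int n = int (N l)] (mod int p ^ l) \<longrightarrow> padic_val p (C_num r n) \<ge> enat l)) \<longrightarrow>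
          (\<forall>l>1. [int (N l) =
                    int (N (l - 1)) -
                    mod_quot (int p ^ l) (C_num r (N (l - 1))) ((-1) ^ (n1 + N (l - 1)) * q_hat r p n1)]
                 (mod int p ^ l))))"
proof -
  have p0: "p > 0" using assms(2) prime_gt_0_nat by blast
  note val = padic_val_eq_0_iff[OF assms(2)] padic_val_pos_iff[OF assms(2)] padic_val_ge_iff[OF assms(2)]
  \<comment> \<open>An equivalence with membership in one explicit class yields existence,
    uniqueness and the formula at once.\<close>
  have lift: "([x = int nk] (mod int p ^ k) \<and>
        (\<forall>n\<ge>r. [int n = x] (mod int p ^ (k + 1)) \<longrightarrow> int p ^ (k + 1) dvd C_num r n)) \<longleftrightarrow>
      [x = int nk - mod_quot (int p ^ (k + 1)) (C_num r nk) (q_hat r p nk)] (mod int p ^ (k + 1))"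
    if "k \<ge> 1" "nk \<ge> r" "int p ^ k dvd C_num r nk" "\<not> int p dvd q_hat r p nk" for k nk :: nat and x
  proof (rule cong_class_iff[where r = r])
    show "[x = int nk] (mod int p ^ k) \<longleftrightarrow> [y = int nk] (mod int p ^ k)"
      if "[x = y] (mod int p ^ (k + 1))" for x y
    proof -
      have "[x = y] (mod int p ^ k)" using that by (rule cong_dvd_modulus) simp
      then show ?thesis using cong_sym cong_trans by blast
    qed
  qed (use p0 dvd_C_num_lift_iff[OF assms(2) that(1-3) _ cong_refl that(4)] in auto)
  have unique: "\<exists>N\<ge>r. \<forall>x. ([x = int n1] (mod int p) \<and>
        (\<forall>n\<ge>r. [int n = x] (mod int p ^ l) \<longrightarrow> int p ^ l dvd C_num r n)) \<longleftrightarrow>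
      [x = int N] (mod int p ^ l)"
    if n1: "n1 \<ge> r" "int p dvd C_num r n1" "\<not> int p dvd q_hat r p n1" "l \<ge> 1" for n1 l
  proof -
    obtain N where N: "N \<ge> r" "\<forall>n\<ge>r. [int n = int n1] (mod int p) \<and> int p ^ l dvd C_num r n \<longleftrightarrow>
        [int n = int N] (mod int p ^ l)"
      using dvd_C_num_class[OF assms(2) n1] by blast
    have "([x = int n1] (mod int p) \<and>
        (\<forall>n\<ge>r. [int n = x] (mod int p ^ l) \<longrightarrow> int p ^ l dvd C_num r n)) \<longleftrightarrow>
      [x = int N] (mod int p ^ l)" for x
    proof (rule cong_class_iff[where r = r])
      show "[x = int n1] (mod int p) \<longleftrightarrow> [y = int n1] (mod int p)"
        if "[x = y] (mod int p ^ l)" for x y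
      proof -
        have "[x = y] (mod int p)" using that by (rule cong_dvd_modulus) (use \<open>l \<ge> 1\<close> in simp)
        then show ?thesis using cong_sym cong_trans by blast
      qed
    qed (use p0 N(2) in auto)
    then show ?thesis using N(1) by blast
  qed
  have newton: "[int (N l) = int (N (l - 1)) - mod_quot (int p ^ l) (C_num r (N (l - 1)))
        ((-1) ^ (n1 + N (l - 1)) * q_hat r p n1)] (mod int p ^ l)"
    if n1: "n1 \<ge> r" "int p dvd C_num r n1" "\<not> int p dvd q_hat r p n1"
      and N: "\<forall>l\<ge>1. N l \<ge> r \<and> [int (N l) = int n1] (mod int p) \<and>
        (\<forall>n\<ge>r. [int n = int (N l)] (mod int p ^ l) \<longrightarrow> int p ^ l dvd C_num r n)"
      and "l > 1" for n1 l and N :: "nat \<Rightarrow> nat"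
  proof -
    obtain k where k: "l = k + 1" "k \<ge> 1" using \<open>l > 1\<close> by (cases l) auto
    have Nk: "N k \<ge> r" "[int (N k) = int n1] (mod int p)" "int p ^ k dvd C_num r (N k)"
      using N k(2) by auto
    have Nl: "N l \<ge> r" "[int (N l) = int n1] (mod int p)" "int p ^ l dvd C_num r (N l)"
      using N \<open>l > 1\<close> by auto
    \<comment> \<open>\<open>N l\<close> also solves the problem modulo \<open>p^k\<close>, so by
      uniqueness it lies in the class of \<open>N k\<close> there.\<close>
    have "int p ^ k dvd C_num r (N l)" using Nl(3) by (rule power_le_dvd) (simp add: k)
    moreover obtain M where "\<forall>n\<ge>r. [int n = int n1] (mod int p) \<and> int p ^ k dvd C_num r n \<longleftrightarrow>
        [int n = int M] (mod int p ^ k)"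
      using dvd_C_num_class[OF assms(2) n1 k(2)] by blast
    ultimately have "[int (N l) = int (N k)] (mod int p ^ k)"
      using Nk Nl cong_sym cong_trans by blast
    \<comment> \<open>The lifting criterion is applied at \<open>N k\<close> with the slope of
      \<open>n1\<close>, its sign corrected by \<open>q_hat_cong\<close>.\<close>
    moreover have "\<not> int p dvd (-1) ^ (n1 + N k) * q_hat r p n1"
      using n1(3) by (simp only: dvd_minus_one_power_mult_iff not_False_eq_True)
    ultimately have "[int (N l) = int (N k) - mod_quot (int p ^ (k + 1)) (C_num r (N k))
        ((-1) ^ (n1 + N k) * q_hat r p n1)] (mod int p ^ (k + 1))"
      using dvd_C_num_lift_iff[OF assms(2) k(2) Nk(1,3) Nl(1) q_hat_cong[OF p0 n1(1) Nk(1,2)]] Nl(3) k(1)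
      by blast
    then show ?thesis by (simp add: k(1))
  qed
  show ?thesis
    unfolding val ex1_mod_def
  proof (intro conjI allI impI, goal_cases)
    case (1 k nk)
    then show ?case using lift[of k nk] by blast
  next
    case (2 k nk x)
    then show ?case using lift[of k nk x] by blast
  next
    case (3 k nk n)
    then show ?case using dvd_C_num_iff_of_dvd_q_hat[OF p0] by blast
  next
    case (4 k nk n)
    then show ?case using dvd_C_num_iff_of_dvd_q_hat[OF p0] by blast
  next
    case (5 n1 l)
    then show ?case using unique[of n1 l] by blast
  next
    case (6 n1 N l)
    then show ?case using newton[of n1 N l] by blast
  qed
qed

end
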